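(* Let $s=\sigma+it$ with $\sigma<\tfrac12$ and $|t|\ge 8$, and suppose $\zeta(s)\neq 0$. Then $$\Re\left(\frac{\eta'(s)}{\eta(s)}\right)<\Re\left(\frac{\zeta'(s)}{\zeta(s)}\right)<\Re\left(\frac{\xi'(s)}{\xi(s)}\right).$$
   Context: $\zeta$ is the Riemann zeta function (meromorphically continued to $\mathbb{C}$). The Riemann xi function is $\xi(s)=(s-1)\Gamma(1+s/2)\pi^{-s/2}\zeta(s)$, an entire function. Euler's eta function is $\eta(s)=(1-2^{1-s})\zeta(s)$, which for $\sigma>0$ equals $\sum_{n\ge1}(-1)^{n+1}n^{-s}$. *)

theory Defs
  imports "HOL-Complex_Analysis.Complex_Analysis"
begin

text \<open>
  The meromorphic continuation of the Dirichlet series. Nice meromorphicity pins down the value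
  at every point (limit values at removable singularities, 0 at poles), so that the continuation
  is unique as a total function; in particular \<open>riemann_zeta 1 = 0\<close> by convention.
\<close>
definition riemann_zeta :: "complex \<Rightarrow> complex" where
  "riemann_zeta =
     (THE f. f nicely_meromorphic_on UNIV \<and>
             (\<forall>s. Re s > 1 \<longrightarrow> f s = (\<Sum>n. 1 / of_nat (Suc n) powr s)))"

text \<open>
  The defining product takes HOL default values at \<open>s = 1\<close> and at the poles \<open>s = -2, -4, \<dots>\<close> of the
  Gamma factor; \<^const>\<open>remove_sings\<close> replaces these by the limits, giving the entire function.
\<close>
definition riemann_xi :: "complex \<Rightarrow> complex" where
  "riemann_xi = remove_sings
     (\<lambda>s. (s - 1) * Gamma (1 + s / 2) * of_real pi powr (- s / 2) * riemann_zeta s)"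

text \<open>Here the only removable singularity is \<open>s = 1\<close>.\<close>
definition euler_eta :: "complex \<Rightarrow> complex" where
  "euler_eta = remove_sings (\<lambda>s. (1 - 2 powr (1 - s)) * riemann_zeta s)"

end

theory Submission
  imports Defs "HOL-Real_Asymp.Real_Asymp"
begin

text \<open>
  Since \<open>\<zeta>(s) \<noteq> 0\<close>, the point \<open>s\<close> is not a pole of \<open>\<zeta>\<close>, and both inequalities concern only the logarithmic
  derivatives of the explicit factors relating \<open>\<eta>\<close> and \<open>\<xi>\<close> to \<open>\<zeta>\<close>. For \<open>\<eta>\<close> this is \<open>w ln 2 / (1 - w)\<close> with
  \<open>w = 2 powr (1 - s)\<close>, whose real part is negative because \<open>\<bar>w\<bar> > 1\<close>. For \<open>\<xi>\<close> it is
  \<open>1 / (s - 1) + \<psi>(1 + s / 2) / 2 - ln \<pi> / 2\<close>, where \<open>Re (1 / (s - 1)) \<ge> - 1 / 16\<close> and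
  \<open>Re \<psi>(z) \<ge> ln 4 - 1 / 16\<close> for \<open>\<bar>Im z\<bar> \<ge> 4\<close>. The latter follows from the limit formula for \<open>\<psi>\<close> by a
  telescoping estimate when \<open>Re z \<ge> 0\<close>, and from there by \<open>\<psi>(z) = \<psi>(z + 1) - 1 / z\<close>.

  That \<open>\<zeta>\<close> has a meromorphic continuation is shown through \<open>\<eta>\<close>: the alternating sums \<open>S\<^sub>m\<close> of the \<open>m\<close>-th
  differences of \<open>n powr (-s)\<close> converge for \<open>Re s > 1 - m\<close> and satisfy \<open>2 S\<^sub>m = \<Delta>\<^sub>m(1) + S\<^sub>m\<^sub>+\<^sub>1\<close>, so each of
  them extends the previous ones.
\<close>

section \<open>Meromorphic continuation of the zeta function\<close>

fun powr_diff :: "nat \<Rightarrow> complex \<Rightarrow> complex \<Rightarrow> complex" where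
  "powr_diff 0 z s = z powr (-s)"
| "powr_diff (Suc m) z s = powr_diff m z s - powr_diff m (z + 1) s"

text \<open>Differencing in \<open>z\<close> commutes with differentiation, so the formula for
  \<open>z powr (-s)\<close> passes to all differences.\<close>

lemma has_field_derivative_powr_diff:
  assumes "Re z > 0"
  shows "((\<lambda>z. powr_diff m z s) has_field_derivative (-s * powr_diff m z (s + 1))) (at z)"
  using assms
proof (induction m arbitrary: z)
  case 0
  then have "z \<notin> \<real>\<^sub>\<le>\<^sub>0" by (auto simp: complex_nonpos_Reals_iff)
  then have "((\<lambda>z. z powr (-s)) has_field_derivative (-s * z powr (-s - 1))) (at z)"
    by (rule has_field_derivative_powr)
  moreover have "-s - 1 = -(s + 1)" by simp
  ultimately show ?case by (simp only: powr_diff.simps)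
next
  case (Suc m)
  have 1: "((\<lambda>z. powr_diff m z s) has_field_derivative (-s * powr_diff m z (s + 1))) (at z)"
    using Suc by simp
  have "((\<lambda>z. powr_diff m z s) has_field_derivative (-s * powr_diff m (z + 1) (s + 1))) (at (z + 1))"
    using Suc by simp
  then have 2: "((\<lambda>z. powr_diff m (z + 1) s) has_field_derivative
      (-s * powr_diff m (z + 1) (s + 1))) (at z)"
    by (simp add: DERIV_shift)
  show ?case
    using DERIV_diff[OF 1 2] by (simp add: algebra_simps)
qed

lemma holomorphic_powr_diff:
  assumes "Re z > 0"
  shows "powr_diff m z holomorphic_on A"
  using assms
proof (induction m arbitrary: z)
  case 0
  then have "z \<noteq> 0" by auto
  have "(\<lambda>s. z powr (-s)) holomorphic_on A"
    using \<open>z \<noteq> 0\<close> by (auto intro!: holomorphic_intros)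
  then show ?case by (simp add: fun_eq_iff cong: holomorphic_cong)
next
  case (Suc m)
  have "(\<lambda>s. powr_diff m z s - powr_diff m (z + 1) s) holomorphic_on A"
    using Suc by (intro holomorphic_on_diff) auto
  then show ?case by (simp cong: holomorphic_cong)
qed

text \<open>By the mean value inequality on \<open>[x, x + 1]\<close>, each difference gains one
  power of decay at the cost of a factor growing with \<open>norm s\<close>. The induction trades
  \<open>Suc m\<close> at \<open>s\<close> for \<open>m\<close> at \<open>s + 1\<close>, which keeps
  the exponent of \<open>x\<close>.\<close>

lemma norm_powr_diff_le:
  assumes "x > 0" "Re s + real m \<ge> 0"
  shows "norm (powr_diff m (of_real x) s) \<le> (norm s + real m) ^ m * x powr (-(Re s + real m))"
  using assms
proof (induction m arbitrary: x s)
  case 0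
  then show ?case by (simp add: norm_powr_real_powr)
next
  case (Suc m)
  \<comment> \<open>Bounds the derivative on the whole segment; \<open>norm (s + 1) + m\<close> is
    absorbed into \<open>norm s + Suc m\<close>.\<close>
  define B where "B = norm s * ((norm s + real (Suc m)) ^ m * x powr (-(Re s + real (Suc m))))"
  have "norm (powr_diff m (of_real x) s - powr_diff m (of_real (x + 1)) s)
          \<le> B * norm (of_real x - of_real (x + 1) :: complex)"
  proof (rule field_differentiable_bound)
    show "convex (complex_of_real ` {x..x+1})"
      by (intro convex_linear_image) (auto simp: linear_of_real)
  next
    fix z assume "z \<in> complex_of_real ` {x..x+1}"
    then obtain y where y: "z = of_real y" "x \<le> y" "y \<le> x + 1" by auto
    show "((\<lambda>z. powr_diff m z s) has_field_derivative (-s * powr_diff m z (s + 1)))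
            (at z within complex_of_real ` {x..x+1})"
      by (rule has_field_derivative_at_within[OF has_field_derivative_powr_diff])
         (use y Suc.prems in auto)
    have "norm (powr_diff m z (s + 1)) \<le>
            (norm (s + 1) + real m) ^ m * y powr (-(Re (s + 1) + real m))"
      unfolding y by (rule Suc.IH) (use y Suc.prems in auto)
    also have "\<dots> \<le> (norm s + real (Suc m)) ^ m * x powr (-(Re s + real (Suc m)))"
    proof (rule mult_mono)
      have "norm (s + 1) \<le> norm s + 1" using norm_triangle_ineq[of s 1] by simp
      then show "(norm (s + 1) + real m) ^ m \<le> (norm s + real (Suc m)) ^ m"
        by (intro power_mono) auto
      show "y powr (-(Re (s + 1) + real m)) \<le> x powr (-(Re s + real (Suc m)))"
        using y Suc.prems powr_mono2'[of "-(Re s + real (Suc m))" x y]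
        by (simp add: algebra_simps)
    qed auto
    finally show "norm (-s * powr_diff m z (s + 1)) \<le> B"
      unfolding B_def norm_mult norm_minus_cancel by (intro mult_left_mono) auto
  qed (auto simp del: of_real_add)
  also have "\<dots> = B" by (simp flip: of_real_diff)
  also have "B \<le> (norm s + real (Suc m)) ^ Suc m * x powr (-(Re s + real (Suc m)))"
    unfolding B_def power_Suc mult.assoc by (intro mult_right_mono) auto
  finally show ?case by simp
qed

section \<open>Alternating sums and the Euler transformation\<close>

definition alt_series :: "nat \<Rightarrow> complex \<Rightarrow> complex" where
  "alt_series m s = (\<Sum>n. (-1) ^ n * powr_diff m (of_nat (Suc n)) s)"

text \<open>The parameters \<open>d\<close> and \<open>R\<close> make the bound uniform in
  \<open>s\<close>, as the M-test on closed balls requires.\<close>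

lemma norm_alt_series_term_le:
  assumes "Re s + real m \<ge> 1 + d" "norm s \<le> R" "d \<ge> 0"
  shows "norm ((-1) ^ n * powr_diff m (of_nat (Suc n)) s)
           \<le> (R + real m) ^ m * real (Suc n) powr (-(1 + d))"
proof -
  have "norm ((-1) ^ n * powr_diff m (of_nat (Suc n)) s) = norm (powr_diff m (of_real (real (Suc n))) s)"
    by (simp add: norm_mult norm_power)
  also have "\<dots> \<le> (norm s + real m) ^ m * real (Suc n) powr (-(Re s + real m))"
    by (rule norm_powr_diff_le) (use assms in auto)
  also have "\<dots> \<le> (R + real m) ^ m * real (Suc n) powr (-(1 + d))"
  proof (rule mult_mono)
    have "R \<ge> 0" using assms(2) norm_ge_zero order_trans by blast
    then show "0 \<le> (R + real m) ^ m" by simp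
    show "(norm s + real m) ^ m \<le> (R + real m) ^ m"
      using assms(2) by (intro power_mono) auto
    show "real (Suc n) powr (-(Re s + real m)) \<le> real (Suc n) powr (-(1 + d))"
      using assms(1) by (intro powr_mono) auto
  qed auto
  finally show ?thesis .
qed

lemma summable_alt_series_bound:
  assumes "d > 0"
  shows "summable (\<lambda>n. C * real (Suc n) powr (-(1 + d)))"
proof -
  have "summable (\<lambda>n. real n powr (-(1 + d)))"
    using assms by (subst summable_real_powr_iff) auto
  then show ?thesis
    by (subst (asm) summable_Suc_iff[symmetric]) (rule summable_mult)
qed

lemma summable_alt_series:
  assumes "Re s > 1 - real m"
  shows "summable (\<lambda>n. (-1) ^ n * powr_diff m (of_nat (Suc n)) s)"
proof (rule summable_comparison_test')
  show "summable (\<lambda>n. (norm s + real m) ^ m * real (Suc n) powr (-(1 + (Re s + real m - 1))))"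
    by (rule summable_alt_series_bound) (use assms in auto)
  show "norm ((-1) ^ n * powr_diff m (of_nat (Suc n)) s)
          \<le> (norm s + real m) ^ m * real (Suc n) powr (-(1 + (Re s + real m - 1)))" for n
    by (rule norm_alt_series_term_le) (use assms in auto)
qed

lemma holomorphic_alt_series: "alt_series m holomorphic_on {s. Re s > 1 - real m}"
proof (rule holomorphic_uniform_sequence)
  show "open {s. Re s > 1 - real m}" by (rule open_halfspace_Re_gt)
  show "(\<lambda>s. \<Sum>n<k. (-1) ^ n * powr_diff m (of_nat (Suc n)) s) holomorphic_on
          {s. Re s > 1 - real m}" for k
    by (intro holomorphic_on_sum holomorphic_on_mult holomorphic_on_const holomorphic_powr_diff) auto
next
  fix s0 assume "s0 \<in> {s. Re s > 1 - real m}"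
  \<comment> \<open>Half the distance of \<open>s0\<close> from the boundary line, so that a margin
    \<open>d\<close> remains on the closed ball.\<close>
  define d where "d = (Re s0 + real m - 1) / 2"
  have d: "d > 0" using \<open>s0 \<in> _\<close> by (auto simp: d_def)
  have *: "Re s + real m \<ge> 1 + d \<and> norm s \<le> norm s0 + d" if "s \<in> cball s0 d" for s
  proof
    have n: "norm (s0 - s) \<le> d" using that by (simp add: dist_norm)
    then show "Re s + real m \<ge> 1 + d"
      using abs_Re_le_cmod[of "s0 - s"] by (simp add: d_def field_simps)
    show "norm s \<le> norm s0 + d"
      using n norm_triangle_sub[of s s0] by (simp add: norm_minus_commute)
  qed
  have "uniform_limit (cball s0 d) (\<lambda>k s. \<Sum>n<k. (-1) ^ n * powr_diff m (of_nat (Suc n)) s)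
          (\<lambda>s. \<Sum>n. (-1) ^ n * powr_diff m (of_nat (Suc n)) s) sequentially"
    by (rule Weierstrass_m_test[OF norm_alt_series_term_le summable_alt_series_bound[OF d]])
       (use * d in auto)
  moreover have "cball s0 d \<subseteq> {s. Re s > 1 - real m}"
    using * d by force
  ultimately show "\<exists>d>0. cball s0 d \<subseteq> {s. Re s > 1 - real m} \<and>
      uniform_limit (cball s0 d) (\<lambda>k s. \<Sum>n<k. (-1) ^ n * powr_diff m (of_nat (Suc n)) s)
        (alt_series m) sequentially"
    using d unfolding alt_series_def[abs_def] by blast
qed

text \<open>Adding the series to its tail from index 1 pairs neighbouring terms into the next
  difference; the tail lacks the term \<open>powr_diff m 1 s\<close>.\<close>

lemma alt_series_Suc:
  assumes "Re s > 1 - real m"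
  shows "alt_series (Suc m) s = 2 * alt_series m s - powr_diff m 1 s"
proof -
  let ?a = "\<lambda>n. (-1) ^ n * powr_diff m (of_nat (Suc n)) s"
  have a: "?a sums alt_series m s"
    unfolding alt_series_def using summable_alt_series[OF assms] by (rule summable_sums)
  then have "(\<lambda>n. ?a (Suc n)) sums (alt_series m s - ?a 0)"
    by (subst sums_Suc_iff) simp
  from sums_add[OF a this] have "(\<lambda>n. ?a n + ?a (Suc n)) sums (2 * alt_series m s - powr_diff m 1 s)"
    by (simp add: algebra_simps)
  also have "(\<lambda>n. ?a n + ?a (Suc n)) = (\<lambda>n. (-1) ^ n * powr_diff (Suc m) (of_nat (Suc n)) s)"
    by (auto simp: algebra_simps)
  finally show ?thesis
    unfolding alt_series_def by (simp add: sums_iff)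
qed

text \<open>The eta series after \<open>m\<close> steps of the Euler transformation, that is, the
  recursion for \<open>alt_series\<close> unrolled from 0 to \<open>m\<close>.\<close>

definition eta_approx :: "nat \<Rightarrow> complex \<Rightarrow> complex" where
  "eta_approx m s = (\<Sum>j<m. powr_diff j 1 s / 2 ^ Suc j) + alt_series m s / 2 ^ m"

lemma eta_approx_Suc:
  assumes "Re s > 1 - real m"
  shows "eta_approx (Suc m) s = eta_approx m s"
  by (simp add: eta_approx_def alt_series_Suc[OF assms] diff_divide_distrib)

lemma eta_approx_eq:
  assumes "Re s > 1 - real m" "Re s > 1 - real n"
  shows "eta_approx m s = eta_approx n s"
proof -
  have *: "eta_approx n s = eta_approx m s" if "m \<le> n" "Re s > 1 - real m" for m n
    using that
  proof (induction n rule: dec_induct)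
    case (step k)
    then show ?case using eta_approx_Suc[of k s] by simp
  qed simp
  show ?thesis
    using *[of m n] *[of n m] assms by (cases "m \<le> n") auto
qed

text \<open>The entire eta function, built without reference to \<open>riemann_zeta\<close>. The
  index is one \<open>m\<close> with \<open>Re s > 1 - m\<close>.\<close>

definition alt_zeta :: "complex \<Rightarrow> complex" where
  "alt_zeta s = eta_approx (nat \<lceil>2 - Re s\<rceil>) s"

lemma alt_zeta_eq: "Re s > 1 - real m \<Longrightarrow> alt_zeta s = eta_approx m s"
  unfolding alt_zeta_def by (rule eta_approx_eq) linarith+

text \<open>Near each point a single \<open>eta_approx m\<close> represents the function on a whole
  half-plane.\<close>

lemma holomorphic_alt_zeta: "alt_zeta holomorphic_on A"
proof -
  have "alt_zeta analytic_on {s0}" for s0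
  proof -
    obtain m where m: "real m > 1 - Re s0" using reals_Archimedean2 by blast
    let ?H = "{s. Re s > 1 - real m}"
    have "eta_approx m holomorphic_on ?H"
      unfolding eta_approx_def[abs_def]
      by (intro holomorphic_intros holomorphic_powr_diff holomorphic_alt_series) auto
    then have "alt_zeta holomorphic_on ?H"
      by (rule holomorphic_transform) (simp add: alt_zeta_eq)
    then show ?thesis
      using m open_halfspace_Re_gt[of "1 - real m"]
      by (auto simp: analytic_at intro!: exI[of _ ?H])
  qed
  then show ?thesis
    by (meson analytic_imp_holomorphic analytic_on_analytic_at)
qed

lemma one_minus_two_powr_nonzero:
  assumes "Re s \<noteq> 0"
  shows "1 - 2 powr s \<noteq> (0 :: complex)"
proof
  assume "1 - 2 powr s = (0 :: complex)"
  then have "norm (2 powr s :: complex) = 1" by simp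
  then have "2 powr Re s = (1 :: real)"
    using norm_powr_real_powr[of 2 s] by simp
  then show False using assms by (simp add: powr_eq_one_iff_gen)
qed

text \<open>Subtracting twice the terms of even integers from the zeta series makes its signs
  alternate.\<close>

lemma alt_zeta_dirichlet:
  assumes "Re s > 1"
  shows "alt_zeta s = (1 - 2 powr (1 - s)) * (\<Sum>n. 1 / of_nat (Suc n) powr s)"
proof -
  let ?a = "\<lambda>n. of_nat (Suc n) powr (-s) :: complex"
  have "summable (\<lambda>n. norm (?a n))"
  proof -
    have "summable (\<lambda>n. 1 * real (Suc n) powr (-(1 + (Re s - 1))))"
      by (rule summable_alt_series_bound) (use assms in auto)
    also have "(\<lambda>n. 1 * real (Suc n) powr (-(1 + (Re s - 1)))) = (\<lambda>n. norm (?a n))"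
      using norm_powr_real_powr[of "of_nat (Suc n)" "-s" for n] by (auto simp del: of_nat_Suc)
    finally show ?thesis .
  qed
  then have a: "?a sums (\<Sum>n. ?a n)"
    by (rule summable_sums[OF summable_norm_cancel])
  have "(\<lambda>k. 2 * (2 powr (-s) * ?a k)) sums (2 * (2 powr (-s) * (\<Sum>n. ?a n)))"
    by (intro sums_mult a)
  \<comment> \<open>Index \<open>2 * k + 1\<close> stands for the integer \<open>2 * Suc k\<close>,
    and its sign -1 produces the factor 2.\<close>
  also have "(\<lambda>k. 2 * (2 powr (-s) * ?a k)) = (\<lambda>k. ?a (2 * k + 1) - (-1) ^ (2 * k + 1) * ?a (2 * k + 1))"
  proof
    fix k :: nat
    have "?a (2 * k + 1) = (of_real 2 * of_real (real (Suc k))) powr (-s)"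
      by (simp add: algebra_simps)
    also have "\<dots> = 2 powr (-s) * ?a k"
      by (subst powr_times_real) (auto simp del: of_nat_Suc)
    finally show "2 * (2 powr (-s) * ?a k) = ?a (2 * k + 1) - (-1) ^ (2 * k + 1) * ?a (2 * k + 1)"
      by simp
  qed
  finally have "(\<lambda>k. ?a (2 * k + 1) - (-1) ^ (2 * k + 1) * ?a (2 * k + 1)) sums
      (2 * (2 powr (-s) * (\<Sum>n. ?a n)))" .
  also have "?this \<longleftrightarrow> (\<lambda>n. ?a n - (-1) ^ n * ?a n) sums (2 * (2 powr (-s) * (\<Sum>n. ?a n)))"
  proof (rule sums_mono_reindex)
    show "strict_mono (\<lambda>k::nat. 2 * k + 1)" by (rule strict_monoI) simp
    show "?a n - (-1) ^ n * ?a n = 0" if "n \<notin> range (\<lambda>k::nat. 2 * k + 1)" for n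
    proof -
      have "even n" using that by (metis oddE rangeI)
      then show ?thesis by simp
    qed
  qed
  finally have "(\<lambda>n. ?a n - (?a n - (-1) ^ n * ?a n)) sums
      ((\<Sum>n. ?a n) - 2 * (2 powr (-s) * (\<Sum>n. ?a n)))"
    by (intro sums_diff a)
  moreover have "2 * (2 powr (-s) * c) = 2 powr (1 - s) * c" for c :: complex
    using powr_add[of 2 1 "-s"] by simp
  ultimately have "(\<lambda>n. (-1) ^ n * ?a n) sums ((1 - 2 powr (1 - s)) * (\<Sum>n. ?a n))"
    by (simp only: left_diff_distrib mult_1 diff_diff_eq2 add_diff_cancel_left')
  then have "alt_series 0 s = (1 - 2 powr (1 - s)) * (\<Sum>n. ?a n)"
    by (simp add: alt_series_def sums_iff)
  moreover have "alt_zeta s = alt_series 0 s"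
    using alt_zeta_eq[of 0 s] assms by (simp add: eta_approx_def)
  ultimately show ?thesis by (simp add: powr_minus_divide)
qed

section \<open>Existence and uniqueness of the continuation\<close>

lemma zeta_continuation_exists:
  "\<exists>f. f nicely_meromorphic_on UNIV \<and> (\<forall>s. Re s > 1 \<longrightarrow> f s = (\<Sum>n. 1 / of_nat (Suc n) powr s))"
proof (intro exI conjI allI impI)
  let ?f = "\<lambda>s. alt_zeta s / (1 - 2 powr (1 - s))"
  have "?f meromorphic_on UNIV"
    by (intro meromorphic_on_divide analytic_on_imp_meromorphic_on)
       (auto simp: analytic_on_open intro!: holomorphic_intros holomorphic_alt_zeta)
  then show "remove_sings ?f nicely_meromorphic_on UNIV"
    by (rule remove_sings_nicely_meromorphic)
  fix s :: complex assume s: "Re s > 1"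
  have nz: "1 - 2 powr (1 - s) \<noteq> (0 :: complex)"
    using one_minus_two_powr_nonzero[of "1 - s"] s by simp
  have "?f analytic_on {s}"
    by (intro analytic_on_divide)
       (use nz in \<open>auto simp: analytic_at intro!: exI[of _ UNIV] holomorphic_intros holomorphic_alt_zeta\<close>)
  then show "remove_sings ?f s = (\<Sum>n. 1 / of_nat (Suc n) powr s)"
    using nz by (simp add: alt_zeta_dirichlet[OF s])
qed

text \<open>The identity theorem makes \<open>f - g\<close> vanish on a punctured neighbourhood of
  every point. Niceness then fixes the value at the point itself: 0 at a common pole, the common
  limit elsewhere.\<close>

lemma nicely_meromorphic_eqI:
  assumes f: "f nicely_meromorphic_on UNIV" and g: "g nicely_meromorphic_on UNIV"
    and eq: "\<exists>\<^sub>F z in at a. f z = g z"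
  shows "f = g"
proof
  fix w
  let ?h = "\<lambda>z. f z - g z"
  have mero: "f meromorphic_on UNIV" "g meromorphic_on UNIV"
    using f g by (auto simp: nicely_meromorphic_on_def)
  then have h: "?h meromorphic_on UNIV" by (rule meromorphic_on_diff)
  have ev: "\<forall>\<^sub>F z in at z0. remove_sings ?h z = ?h z" for z0
    by (rule eventually_remove_sings_eq_at, rule meromorphic_on_isolated_singularity)
       (use h in \<open>auto intro: meromorphic_on_subset\<close>)
  have "\<exists>\<^sub>F z in at a. remove_sings ?h z = 0"
    using frequently_eventually_frequently[OF eq ev[of a]] by (rule frequently_elim1) auto
  then have "remove_sings ?h z = 0" for z
    by (rule frequently_eq_meromorphic_imp_constant[OF _ remove_sings_nicely_meromorphic[OF h]]) auto
  with ev[of w] have fg: "\<forall>\<^sub>F z in at w. f z = g z"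
    by (auto elim: eventually_mono)
  have pole: "is_pole f w \<longleftrightarrow> is_pole g w"
    by (rule is_pole_cong) (use fg in auto)
  show "f w = g w"
  proof (cases "is_pole f w")
    case True
    then show ?thesis
      using f g pole by (simp add: nicely_meromorphic_on_imp_analytic_at nicely_meromorphic_on_def)
         (metis is_pole_def not_tendsto_and_filterlim_at_infinity trivial_limit_at)
  next
    case False
    have "f \<midarrow>w\<rightarrow> f w" "g \<midarrow>w\<rightarrow> g w"
      using f g False pole by (auto simp: nicely_meromorphic_on_def)
    then show ?thesis
      using fg tendsto_cong LIM_unique by metis
  qed
qed

text \<open>Shows that the \<open>THE\<close> in the definition denotes; agreement near 2 suffices
  for uniqueness.\<close>

lemma riemann_zeta_nicely_meromorphic: "riemann_zeta nicely_meromorphic_on UNIV"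
proof -
  let ?P = "\<lambda>f. f nicely_meromorphic_on UNIV \<and>
             (\<forall>s. Re s > 1 \<longrightarrow> f s = (\<Sum>n. 1 / of_nat (Suc n) powr s))"
  have "\<exists>!f. ?P f"
  proof (rule ex_ex1I)
    fix f g assume fg: "?P f" "?P g"
    have "\<forall>\<^sub>F z in at 2. z \<in> {z :: complex. Re z > 1}"
      by (rule eventually_at_in_open') (auto simp: open_halfspace_Re_gt)
    then have "\<forall>\<^sub>F z in at 2. f z = g z"
      by eventually_elim (use fg in auto)
    then have "\<exists>\<^sub>F z in at 2. f z = g z"
      by (rule eventually_frequently[rotated]) simp
    then show "f = g" using fg nicely_meromorphic_eqI by blast
  qed (rule zeta_continuation_exists)
  from theI'[OF this] show ?thesis unfolding riemann_zeta_def by blast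
qed

text \<open>Niceness assigns 0 to poles, so a nonzero value excludes a pole.\<close>

lemma riemann_zeta_analytic_at:
  assumes "riemann_zeta s \<noteq> 0"
  shows "riemann_zeta analytic_on {s}"
proof (rule nicely_meromorphic_on_imp_analytic_at[OF riemann_zeta_nicely_meromorphic])
  show "\<not> is_pole riemann_zeta s"
    using assms riemann_zeta_nicely_meromorphic unfolding nicely_meromorphic_on_def
    by (metis UNIV_I is_pole_def not_tendsto_and_filterlim_at_infinity trivial_limit_at)
qed simp

section \<open>Logarithmic derivatives\<close>

text \<open>The product is analytic at \<open>s\<close>, so \<open>remove_sings\<close> changes
  neither its value nor its derivative there. The constant \<open>c\<close> is the logarithmic
  derivative of \<open>h\<close>.\<close>

lemma logderiv_remove_sings_mult:
  fixes g h :: "complex \<Rightarrow> complex"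
  assumes "h analytic_on {s}" "g analytic_on {s}" "h s \<noteq> 0" "g s \<noteq> 0"
    and "(h has_field_derivative c * h s) (at s)"
  shows "deriv (remove_sings (\<lambda>s. h s * g s)) s / remove_sings (\<lambda>s. h s * g s) s
           = c + deriv g s / g s"
proof -
  have an: "(\<lambda>s. h s * g s) analytic_on {s}"
    using assms by (intro analytic_on_mult) auto
  have "(g has_field_derivative deriv g s) (at s)"
    using assms(2) by (simp add: analytic_on_imp_differentiable_at DERIV_deriv_iff_field_differentiable)
  from DERIV_imp_deriv[OF DERIV_mult[OF assms(5) this]] assms an show ?thesis
    by (simp add: field_simps)
qed

text \<open>The real part has the sign of \<open>Re w - (norm w)\<^sup>2\<close>, and
  \<open>Re w \<le> norm w\<close>.\<close>

lemma Re_over_one_minus_neg: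
  fixes w :: complex
  assumes "norm w > 1"
  shows "Re (w / (1 - w)) < 0"
proof -
  have "Re w < (norm w)\<^sup>2"
    using complex_Re_le_cmod[of w] assms by (smt (verit) power2_eq_square mult_less_cancel_right1)
  moreover have "w \<noteq> 1" using assms by auto
  then have "(Re (1 - w))\<^sup>2 + (Im (1 - w))\<^sup>2 > 0"
    by (smt (verit) complex_eqI eq_iff_diff_eq_0 sum_power2_gt_zero_iff zero_complex.sel)
  ultimately show ?thesis
    unfolding Re_divide by (intro divide_neg_pos) (simp_all only: cmod_power2, simp_all add: algebra_simps power2_eq_square)
qed

section \<open>A lower bound for the digamma function\<close>

text \<open>This is \<open>artanh x \<ge> x\<close> at \<open>x = u / B\<close>; the difference of
  the two sides vanishes at 0 and increases.\<close>

lemma ln_ratio_ge: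
  fixes B u :: real
  assumes "0 \<le> u" "u < B"
  shows "2 * u / B \<le> ln (B + u) - ln (B - u)"
proof -
  let ?f = "\<lambda>v. ln (B + v) - ln (B - v) - 2 * v / B"
  have "?f 0 \<le> ?f u"
  proof (rule DERIV_nonneg_imp_nondecreasing[OF assms(1)])
    fix v assume v: "0 \<le> v" "v \<le> u"
    then have pos: "B + v > 0" "B - v > 0" "B > 0" using assms by auto
    have "(?f has_real_derivative 1 / (B + v) + 1 / (B - v) - 2 / B) (at v)"
      using pos by (auto intro!: derivative_eq_intros)
    moreover have "1 / (B + v) + 1 / (B - v) - 2 / B = 2 * v\<^sup>2 / (B * (B + v) * (B - v))"
    proof -
      have "1 / (B + v) + 1 / (B - v) = 2 * B / ((B + v) * (B - v))"
        using pos by (simp add: field_simps)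
      also have "\<dots> - 2 / B = (2 * B * B - 2 * ((B + v) * (B - v))) / (B * (B + v) * (B - v))"
        using pos by (subst diff_frac_eq) (auto simp: mult_ac)
      also have "2 * B * B - 2 * ((B + v) * (B - v)) = 2 * v\<^sup>2"
        by (simp add: algebra_simps power2_eq_square)
      finally show ?thesis .
    qed
    ultimately show "\<exists>y. (?f has_real_derivative y) (at v) \<and> 0 \<le> y"
      using pos by (intro exI[of _ "2 * v\<^sup>2 / (B * (B + v) * (B - v))"]) auto
  qed
  then show ?thesis by simp
qed

text \<open>
  The logarithmic terms alone would match the summand up to \<open>O(u / (u\<^sup>2 + y\<^sup>2)\<^sup>2)\<close>; the rational
  terms absorb this error.
\<close>
lemma telescoping_bound:
  fixes u y :: real
  assumes "u \<ge> 0" "\<bar>y\<bar> \<ge> 1"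
  defines "G \<equiv> \<lambda>v. ln (v\<^sup>2 + y\<^sup>2) / 2 - 1 / (v\<^sup>2 + y\<^sup>2)"
  shows "u / (u\<^sup>2 + y\<^sup>2) \<le> G (u + 1 / 2) - G (u - 1 / 2)"
proof -
  define A where "A = u\<^sup>2 + y\<^sup>2"
  \<comment> \<open>Chosen so that the arguments of \<open>G\<close> at \<open>u + 1 / 2\<close> and
    \<open>u - 1 / 2\<close> give \<open>B + u\<close> and \<open>B - u\<close>.\<close>
  define B where "B = A + 1 / 4"
  have y1: "y\<^sup>2 \<ge> 1" using assms(2) by (simp add: abs_le_square_iff[of 1 y, simplified])
  then have A: "A \<ge> 1" by (simp add: A_def add_increasing)
  have e: "(u + 1 / 2)\<^sup>2 + y\<^sup>2 = B + u" "(u - 1 / 2)\<^sup>2 + y\<^sup>2 = B - u"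
    by (simp_all add: A_def B_def power2_eq_square algebra_simps)
  have "0 < (u - 1 / 2)\<^sup>2 + y\<^sup>2" using y1 by (intro add_nonneg_pos) auto
  then have Bu: "u < B" using e by simp
  have B: "B > 0" using A by (auto simp: B_def)
  \<comment> \<open>The error \<open>u / A - u / B\<close> equals
    \<open>2 * u / (8 * (A * B))\<close>, so this makes the rational terms of \<open>G\<close> cover
    it.\<close>
  have le: "(B + u) * (B - u) \<le> 8 * (A * B)"
  proof -
    have "(B + u) * (B - u) \<le> B * B" by (simp add: algebra_simps)
    also have "\<dots> \<le> (8 * A) * B" using A B by (intro mult_right_mono) (auto simp: B_def)
    finally show ?thesis by simp
  qed
  have "u / A - u / B = 2 * u / (8 * (A * B))"
  proof -
    have "u / A - u / B = u * (B - A) / (A * B)"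
      using A B by (simp add: field_simps)
    also have "B - A = 1 / 4" by (simp add: B_def)
    finally show ?thesis by simp
  qed
  also have "\<dots> \<le> 2 * u / ((B + u) * (B - u))"
    using le Bu A B assms(1) by (intro divide_left_mono mult_pos_pos) auto
  also have "\<dots> = 1 / (B - u) - 1 / (B + u)"
    using Bu B assms(1) by (simp add: field_simps)
  finally have "u / A \<le> u / B + 1 / (B - u) - 1 / (B + u)" by simp
  moreover have "2 * u / B \<le> ln (B + u) - ln (B - u)"
    using assms(1) Bu by (rule ln_ratio_ge)
  ultimately have "u / A \<le> (ln (B + u) / 2 - 1 / (B + u)) - (ln (B - u) / 2 - 1 / (B - u))"
    by simp
  then show ?thesis
    unfolding G_def e by (simp only: A_def)
qed

lemma Re_Digamma_ge_right:
  fixes z :: complex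
  assumes "Re z \<ge> 0" "\<bar>Im z\<bar> \<ge> 4"
  shows "ln 4 - 1 / 16 \<le> Re (Digamma z)"
proof -
  define x y where "x = Re z" and "y = Im z"
  define G where "G = (\<lambda>v. ln (v\<^sup>2 + y\<^sup>2) / 2 - 1 / (v\<^sup>2 + y\<^sup>2))"
  have y2: "y\<^sup>2 \<ge> 16" using assms(2) abs_le_square_iff[of 4 y] by (simp add: y_def)
  have "z \<noteq> 0" using assms by auto
  have lim: "(\<lambda>m. Re (of_real (ln (real m)) - (\<Sum>n<m. inverse (z + of_nat n)))) \<longlonglongrightarrow> Re (Digamma z)"
    by (intro tendsto_Re Digamma_LIMSEQ \<open>z \<noteq> 0\<close>)
  have le: "ln (real m) - G (x + real m - 1 / 2) + G (x - 1 / 2)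
          \<le> Re (of_real (ln (real m)) - (\<Sum>n<m. inverse (z + of_nat n)))" for m
  proof -
    have "Re (\<Sum>n<m. inverse (z + of_nat n)) = (\<Sum>n<m. (x + real n) / ((x + real n)\<^sup>2 + y\<^sup>2))"
      by (simp add: x_def y_def)
    also have "\<dots> \<le> (\<Sum>n<m. G (x + real n + 1 / 2) - G (x + real n - 1 / 2))"
      unfolding G_def
      by (intro sum_mono telescoping_bound) (use assms in \<open>auto simp: x_def y_def\<close>)
    also have "\<dots> = (\<Sum>n<m. G (x + real (Suc n) - 1 / 2) - G (x + real n - 1 / 2))"
      by (simp add: algebra_simps)
    also have "\<dots> = G (x + real m - 1 / 2) - G (x - 1 / 2)"
      by (subst sum_lessThan_telescope) simp
    finally show ?thesis by simp
  qed
  \<comment> \<open>As \<open>G v = ln v + o(1)\<close>, only the lower end of the telescoping sum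
    survives in the limit.\<close>
  have "(\<lambda>m. ln (real m) - G (x + real m - 1 / 2)) \<longlonglongrightarrow> 0"
    unfolding G_def by real_asymp
  from tendsto_add[OF this tendsto_const[of "G (x - 1 / 2)"]]
  have "(\<lambda>m. ln (real m) - G (x + real m - 1 / 2) + G (x - 1 / 2)) \<longlonglongrightarrow> G (x - 1 / 2)"
    by simp
  then have "G (x - 1 / 2) \<le> Re (Digamma z)"
    by (rule LIMSEQ_le[OF _ lim]) (use le in blast)
  moreover have "ln 4 - 1 / 16 \<le> G (x - 1 / 2)"
  proof -
    have q: "(x - 1 / 2)\<^sup>2 + y\<^sup>2 \<ge> 16" using y2 by (simp add: add_increasing)
    have "ln (4\<^sup>2 :: real) \<le> ln ((x - 1 / 2)\<^sup>2 + y\<^sup>2)" using q by (subst ln_le_cancel_iff) auto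
    then have "2 * ln 4 \<le> ln ((x - 1 / 2)\<^sup>2 + y\<^sup>2)" by (subst (asm) ln_realpow) auto
    moreover have "1 / ((x - 1 / 2)\<^sup>2 + y\<^sup>2) \<le> 1 / 16" using q by (intro divide_left_mono) auto
    ultimately show ?thesis by (simp add: G_def)
  qed
  ultimately show ?thesis by simp
qed

text \<open>Induction on the number of unit shifts into the right half-plane. Where
  \<open>Re z < 0\<close>, also \<open>Re (1 / z) < 0\<close>, so shifting back to \<open>z\<close>
  can only raise the real part.\<close>

lemma Re_Digamma_ge:
  fixes z :: complex
  assumes "\<bar>Im z\<bar> \<ge> 4"
  shows "ln 4 - 1 / 16 \<le> Re (Digamma z)"
proof -
  have "Re z \<ge> - real n \<Longrightarrow> \<bar>Im z\<bar> \<ge> 4 \<Longrightarrow> ln 4 - 1 / 16 \<le> Re (Digamma z)" for n z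
  proof (induction n arbitrary: z)
    case 0
    then show ?case by (intro Re_Digamma_ge_right) auto
  next
    case (Suc n)
    show ?case
    proof (cases "Re z \<ge> 0")
      case True
      then show ?thesis using Suc.prems by (intro Re_Digamma_ge_right)
    next
      case False
      have "z \<noteq> 0" using Suc.prems by auto
      have "ln 4 - 1 / 16 \<le> Re (Digamma (z + 1))"
        by (rule Suc.IH) (use Suc.prems in auto)
      also have "\<dots> = Re (Digamma z) + Re z / ((Re z)\<^sup>2 + (Im z)\<^sup>2)"
        using \<open>z \<noteq> 0\<close> by (simp add: Digamma_plus1 Re_divide)
      also have "\<dots> \<le> Re (Digamma z)"
        using False by (simp add: divide_nonpos_nonneg)
      finally show ?thesis .
    qed
  qed
  moreover obtain n where "real n \<ge> - Re z" using real_arch_simple by blast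
  ultimately show ?thesis using assms by (metis minus_le_iff)
qed

text \<open>After clearing denominators this is \<open>(a + 8)\<^sup>2 \<ge> 0\<close> together with
  \<open>b\<^sup>2 \<ge> 64\<close>.\<close>

lemma Re_inverse_ge:
  fixes w :: complex
  assumes "\<bar>Im w\<bar> \<ge> 8"
  shows "Re (1 / w) \<ge> - 1 / 16"
proof -
  define a b where "a = Re w" and "b = Im w"
  have "b\<^sup>2 \<ge> 64" using assms abs_le_square_iff[of 8 b] by (simp add: b_def)
  moreover have "(a + 8)\<^sup>2 \<ge> 0" by simp
  ultimately have "a\<^sup>2 + b\<^sup>2 > 0" "- (a\<^sup>2 + b\<^sup>2) \<le> 16 * a"
    by (auto simp: power2_eq_square algebra_simps intro: add_nonneg_pos)
  then have "- 1 / 16 \<le> a / (a\<^sup>2 + b\<^sup>2)" by (simp add: field_simps)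
  then show ?thesis by (simp add: a_def b_def Re_divide)
qed

text \<open>The tangent of \<open>ln\<close> at 1, taken at \<open>pi / 4\<close>, gives
  \<open>ln pi < ln 4 - 1 / 5\<close>. The total then exceeds
  \<open>1 / 10 - 1 / 16 - 1 / 32 > 0\<close>.\<close>

lemma Re_logderiv_xi_factor_pos:
  fixes s :: complex
  assumes "\<bar>Im s\<bar> \<ge> 8"
  shows "0 < Re (1 / (s - 1) + Digamma (1 + s / 2) / 2 - of_real (ln pi) / 2)"
proof -
  have "ln (pi / 4) \<le> pi / 4 - 1" by (rule ln_le_minus_one) simp
  then have "ln pi \<le> ln 4 + pi / 4 - 1" by (simp add: ln_div)
  moreover have "ln 4 - 1 / 16 \<le> Re (Digamma (1 + s / 2))"
    by (rule Re_Digamma_ge) (use assms in auto)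
  moreover have "- 1 / 16 \<le> Re (1 / (s - 1))"
    by (rule Re_inverse_ge) (use assms in auto)
  moreover have "Re (1 / (s - 1) + Digamma (1 + s / 2) / 2 - of_real (ln pi) / 2)
      = Re (1 / (s - 1)) + Re (Digamma (1 + s / 2)) / 2 - ln pi / 2"
    by simp
  moreover have "pi < 3.2" using pi_approx(2) by simp
  ultimately show ?thesis by argo
qed

theorem theorem1p3:
  fixes s :: complex
  assumes "Re s < 1 / 2" and "\<bar>Im s\<bar> \<ge> 8" and "riemann_zeta s \<noteq> 0"
  shows "Re (deriv euler_eta s / euler_eta s) < Re (deriv riemann_zeta s / riemann_zeta s) \<and>
         Re (deriv riemann_zeta s / riemann_zeta s) < Re (deriv riemann_xi s / riemann_xi s)"
proof
  let ?w = "2 powr (1 - s)" and ?e = "\<lambda>s. 1 - 2 powr (1 - s) :: complex"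
  note zeta = riemann_zeta_analytic_at[OF assms(3)]
  have w: "norm ?w > 1"
    using assms(1) norm_powr_real_powr[of 2 "1 - s"] by simp
  have e: "?e s \<noteq> 0" using assms(1) by (intro one_minus_two_powr_nonzero) auto
  have "?e analytic_on {s}" by (auto simp: analytic_at intro!: exI[of _ UNIV] holomorphic_intros)
  \<comment> \<open>The derivative is \<open>ln 2 * ?w\<close>; the quotient by
    \<open>?e s = 1 - ?w\<close> is split off to expose the logarithmic derivative.\<close>
  moreover have "(?e has_field_derivative (of_real (ln 2) * (?w / (1 - ?w))) * ?e s) (at s)"
  proof -
    have "((\<lambda>s. 2 powr (1 - s)) has_field_derivative (Ln 2 * ?w) * (-1)) (at s)"
      by (rule DERIV_chain2[OF has_field_derivative_powr_right]) (auto intro!: derivative_eq_intros)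
    from DERIV_diff[OF DERIV_const[of 1] this] show ?thesis
      using e Ln_of_real[of 2] by simp
  qed
  ultimately have "deriv euler_eta s / euler_eta s
      = of_real (ln 2) * (?w / (1 - ?w)) + deriv riemann_zeta s / riemann_zeta s"
    unfolding euler_eta_def using zeta assms(3) e by (intro logderiv_remove_sings_mult)
  moreover have "Re (of_real (ln 2) * (?w / (1 - ?w))) < 0"
  proof -
    have "Re (of_real (ln 2) * (?w / (1 - ?w))) = ln 2 * Re (?w / (1 - ?w))"
      by (simp only: scaleR_conv_of_real[symmetric] scaleR_complex.sel)
    then show ?thesis using Re_over_one_minus_neg[OF w] by (simp only:) (simp add: mult_pos_neg)
  qed
  ultimately show "Re (deriv euler_eta s / euler_eta s) < Re (deriv riemann_zeta s / riemann_zeta s)"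
    by simp

  let ?h = "\<lambda>s. (s - 1) * Gamma (1 + s / 2) * of_real pi powr (- s / 2) :: complex"
  let ?c = "1 / (s - 1) + Digamma (1 + s / 2) / 2 - of_real (ln pi) / 2"
  \<comment> \<open>The poles of the Gamma factor all lie on the real axis.\<close>
  have np: "1 + z / 2 \<notin> \<int>\<^sub>\<le>\<^sub>0" if "Im z \<noteq> 0" for z :: complex
    using that by (auto elim!: nonpos_Ints_cases simp: complex_eq_iff)
  have s: "Im s \<noteq> 0" "s \<noteq> 1" using assms(2) by auto
  have h: "?h s \<noteq> 0" using s np[of s] by (simp add: Gamma_eq_zero_iff)
  have op: "open {z. Im z \<noteq> 0}"
    by (intro open_Collect_neq continuous_intros)
  have "?h holomorphic_on {z. Im z \<noteq> 0}"
    using np by (auto intro!: holomorphic_intros)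
  then have "?h analytic_on {s}"
    using op s by (auto simp: analytic_at)
  moreover have "(?h has_field_derivative ?c * ?h s) (at s)"
  proof -
    have "((\<lambda>s. of_real pi powr (- s / 2)) has_field_derivative
        (Ln (of_real pi) * of_real pi powr (- s / 2)) * (- 1 / 2)) (at s)"
      by (rule DERIV_chain2[OF has_field_derivative_powr_right]) (auto intro!: derivative_eq_intros)
    moreover have "((\<lambda>s. Gamma (1 + s / 2)) has_field_derivative
        (Gamma (1 + s / 2) * Digamma (1 + s / 2)) * (1 / 2)) (at s)"
      by (rule DERIV_chain2[OF has_field_derivative_Gamma])
         (use np[OF s(1)] in \<open>auto intro!: derivative_eq_intros\<close>)
    moreover have "((\<lambda>s. s - 1) has_field_derivative 1) (at s)"
      by (auto intro!: derivative_eq_intros)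
    ultimately have "(?h has_field_derivative
        (1 * Gamma (1 + s / 2) + Gamma (1 + s / 2) * Digamma (1 + s / 2) * (1 / 2) * (s - 1))
          * of_real pi powr (- s / 2)
        + Ln (of_real pi) * of_real pi powr (- s / 2) * (- 1 / 2) * ((s - 1) * Gamma (1 + s / 2))) (at s)"
      by (intro DERIV_mult)
    also have "Ln (of_real pi) = complex_of_real (ln pi)" by (simp add: Ln_of_real)
    finally show ?thesis
      by (rule DERIV_cong) (use s(2) in \<open>simp add: field_simps\<close>)
  qed
  ultimately have "deriv riemann_xi s / riemann_xi s = ?c + deriv riemann_zeta s / riemann_zeta s"
    unfolding riemann_xi_def using zeta assms(3) h by (intro logderiv_remove_sings_mult)
  then show "Re (deriv riemann_zeta s / riemann_zeta s) < Re (deriv riemann_xi s / riemann_xi s)"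
    using Re_logderiv_xi_factor_pos[OF assms(2)] by simp
qed

end
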